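(* In the general Bayes factor setting described in the context, let $\tau$ be any stopping time with $\bar P_0(\tau=\infty\mid x^m)=\bar P_1(\tau=\infty\mid x^m)=0$ for all $x^m\in\langle\mathcal X^m\rangle$. Let $\beta_{\tau\mid m}=\sum_{j=m+1}^\infty\mathbf 1_{\{\tau=j\}}\beta_{j\mid m}$ be the stopped Bayes factor given $x^m$. Then for ($\rho^{(m)}$-almost) every $x^m\in\langle\mathcal X^m\rangle$, $$\mathbf E_{\bar P_0(\cdot\mid x^m)}\left[\beta_{\tau\mid m}\right]\le 1,$$ so that, for every $0\le\alpha\le 1$, $$\bar P_0\left(\frac{1}{\beta_{\tau\mid m}}\le\alpha\,\Big|\,x^m\right)\le\alpha .$$
   Context: General setting. $(\Omega,\mathcal F)$ is a measurable space, $m\ge 0$ an integer, and $X_{m+1},X_{m+2},\dots$ are measurable functions on $\Omega$ with values in a measurable space $(\mathcal X,\Sigma)$. If $m>0$ there is in addition an initial sample $\langle X^{(m)}\rangle:\Omega\to\langle\mathcal X^m\rangle\subseteq\mathcal X^m$, where $\langle\mathcal X^m\rangle$ carries a $\sigma$-algebra. If $m=0$ there is no initial sample and conditioning on $x^m$ is vacuous. For $n\ge m$, $\langle\mathcal X^n\rangle=\{x^n\in\mathcal X^n:(x_1,\dots,x_m)\in\langle\mathcal X^m\rangle\}$ with the product $\sigma$-algebra, $X^n=(\langle X^{(m)}\rangle,X_{m+1},\dots,X_n)$, and $\mathcal F_n$ is the $\sigma$-algebra on $\Omega$ generated by $X^n$. For $x^n\in\langle\mathcal X^n\rangle$, $x^m$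 denotes its initial segment. A stopping time is a function $\tau:\Omega\to\{m+1,m+2,\dots\}\cup\{\infty\}$ with $\{\tau=n\}\in\mathcal F_n$ for all $n>m$. For a measure $Q$ on $(\Omega,\mathcal F)$, $Q^{(n)}$ is the distribution of $X^n$ under $Q$. Hypotheses. For $k\in\{0,1\}$, $H_k=\{P_{\theta\mid k}:\theta\in\Theta_k\}$ is a set of probability measures on $(\Omega,\mathcal F)$, $\Theta_k$ carries a suitable $\sigma$-algebra, and $\pi_k$ is a possibly improper (infinite) prior measure on $\Theta_k$. The Bayes marginal is $\bar P_k(A)=\int_{\Theta_k}P_{\theta\mid k}(A)\,\mathrm d\pi_k(\theta)$, a possibly infinite measure. Standing assumptions. For all $n\ge\max\{m,1\}$, all $k$ and $\theta\in\Theta_k$, the measures $P^{(n)}_{\theta\mid k},\bar P_0^{(n)},\bar P_1^{(n)}$ are mutually absolutely continuous, and $\bar P_0^{(n)},\bar P_1^{(n)}$ are $\sigma$-finite. $\rho$ is a measure on $(\Omega,\mathcal F)$ such that for these $n$, $\rho^{(n)}$ is mutually absolutely continuous with them (e.g. $\rho^{(n)}=\bar P_0^{(n)}$). For every $x^m\in\langle\mathcal X^m\rangle$ the posterior $$\pi_k(\Theta_k'\mid x^m)=\frac{\int_{\Theta_k'}\frac{\mathrm dP^{(m)}_{\theta\mid k}}{\mathrm d\rho^{(m)}}(x^m)\,\mathrm d\pi_k(\theta)}{\int_{\Theta_k}\frac{\mathrm dP^{(m)}_{\theta\mid k}}{\mathrm d\rho^{(m)}}(x^m)\,\mathrm d\pi_k(\theta)}$$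 is a probability measure (for $m=0$ it is the prior $\pi_k$, which is then proper). Conditional marginals. $\bar P_k(A\mid x^m)=\int_{\Theta_k}P_{\theta\mid k}(A\mid\langle X^{(m)}\rangle=x^m)\,\mathrm d\pi_k(\theta\mid x^m)$, where $P_{\theta\mid k}(A\mid\langle X^{(m)}\rangle=x^m)$ is the value at $x^m$ of a version of the conditional probability given $\mathcal F_m$, thus defined up to a set of $\rho^{(m)}$-measure $0$. $\bar P_k(\cdot\mid x^m)$ is a probability measure on $(\Omega,\mathcal F)$. Conditional Bayes factor. For $n>m$, $\beta_{n\mid m}=\dfrac{\mathrm d\bar P_1^{(n)}(\cdot\mid x^m)}{\mathrm d\bar P_0^{(n)}(\cdot\mid x^m)}(X^n)$, where $\bar P_k^{(n)}(\cdot\mid x^m)$ is the distribution of $X^n$ under $\bar P_k(\cdot\mid x^m)$. Convention: $1/0=\infty$. *)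

theory Defs
  imports "HOL-Probability.Probability" "HOL-Library.Extended_Nat"
begin

text \<open>
  A point \<open>x\<^sup>n\<close> is an extensional function on \<open>{1..n}\<close>, so for \<open>n = 0\<close> there is exactly one.
  The two parameter sets \<open>\<Theta>\<^sub>0, \<Theta>\<^sub>1\<close> live in one type; \<open>\<Theta>\<^sub>k\<close> is \<open>space (prior E k)\<close>.  The fields
  \<open>init_density\<close> and \<open>cond_prob\<close> are arbitrary versions of
  \<open>dP\<^sub>\<theta>\<^sub>|\<^sub>k\<^sup>(\<^sup>m\<^sup>) / d\<rho>\<^sup>(\<^sup>m\<^sup>) (x\<^sup>m)\<close> and \<open>P\<^sub>\<theta>\<^sub>|\<^sub>k(A | X\<^sup>m = x\<^sup>m)\<close>;
  locale \<open>bayes_setting\<close> below says that they are versions.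
\<close>

record ('w, 'x, 't) bayes_setup =
  Omega :: "'w measure"
  obs_space :: "'x measure"
  init_len :: nat
  init_space :: "(nat \<Rightarrow> 'x) measure"
  init_sample :: "'w \<Rightarrow> nat \<Rightarrow> 'x"
  obs :: "nat \<Rightarrow> 'w \<Rightarrow> 'x"
  model :: "nat \<Rightarrow> 't \<Rightarrow> 'w measure"
  prior :: "nat \<Rightarrow> 't measure"
  ref_measure :: "'w measure"
  init_density :: "nat \<Rightarrow> 't \<Rightarrow> (nat \<Rightarrow> 'x) \<Rightarrow> ennreal"
  cond_prob :: "nat \<Rightarrow> 't \<Rightarrow> (nat \<Rightarrow> 'x) \<Rightarrow> 'w set \<Rightarrow> ennreal"

text \<open>
  The product \<open>\<sigma>\<close>-algebra on \<open>{x\<^sup>n. (x\<^sub>1, \<dots>, x\<^sub>m) \<in> \<langle>\<X>\<^sup>m\<rangle>}\<close> is the pullback of the product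
  \<open>\<sigma>\<close>-algebra along \<open>x\<^sup>n \<mapsto> ((x\<^sub>1, \<dots>, x\<^sub>m), (x\<^sub>m\<^sub>+\<^sub>1, \<dots>, x\<^sub>n))\<close>.
\<close>

definition sample_space :: "('w, 'x, 't) bayes_setup \<Rightarrow> nat \<Rightarrow> (nat \<Rightarrow> 'x) measure" where
  "sample_space E n =
     vimage_algebra
       {x \<in> {1..n} \<rightarrow>\<^sub>E space (obs_space E). restrict x {1..init_len E} \<in> space (init_space E)}
       (\<lambda>x. (restrict x {1..init_len E}, restrict x {init_len E<..n}))
       (init_space E \<Otimes>\<^sub>M (\<Pi>\<^sub>M i\<in>{init_len E<..n}. obs_space E))"

definition sample :: "('w, 'x, 't) bayes_setup \<Rightarrow> nat \<Rightarrow> 'w \<Rightarrow> nat \<Rightarrow> 'x" where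
  "sample E n \<omega> = (\<lambda>i\<in>{1..n}. if i \<le> init_len E then init_sample E \<omega> i else obs E i \<omega>)"

definition sample_algebra :: "('w, 'x, 't) bayes_setup \<Rightarrow> nat \<Rightarrow> 'w measure" where
  "sample_algebra E n = vimage_algebra (space (Omega E)) (sample E n) (sample_space E n)"

definition sample_distr ::
  "('w, 'x, 't) bayes_setup \<Rightarrow> nat \<Rightarrow> 'w measure \<Rightarrow> (nat \<Rightarrow> 'x) measure" where
  "sample_distr E n Q = distr Q (sample_space E n) (sample E n)"

definition mixture :: "'w measure \<Rightarrow> 't measure \<Rightarrow> ('t \<Rightarrow> 'w set \<Rightarrow> ennreal) \<Rightarrow> 'w measure" where
  "mixture F \<pi> K = measure_of (space F) (sets F) (\<lambda>A. \<integral>\<^sup>+\<theta>. K \<theta> A \<partial>\<pi>)"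

definition marginal :: "('w, 'x, 't) bayes_setup \<Rightarrow> nat \<Rightarrow> 'w measure" where
  "marginal E k = mixture (Omega E) (prior E k) (\<lambda>\<theta>. emeasure (model E k \<theta>))"

text \<open>
  The case \<open>m = 0\<close> is separate because \<open>\<rho>\<close> may be infinite, and then \<open>P\<^sub>\<theta>\<^sub>|\<^sub>k\<^sup>(\<^sup>0\<^sup>)\<close>
  has no density with respect to the point mass \<open>\<rho>\<^sup>(\<^sup>0\<^sup>)\<close>.
\<close>

definition posterior :: "('w, 'x, 't) bayes_setup \<Rightarrow> nat \<Rightarrow> (nat \<Rightarrow> 'x) \<Rightarrow> 't measure" where
  "posterior E k x =
     (if init_len E = 0 then prior E k
      else measure_of (space (prior E k)) (sets (prior E k))
        (\<lambda>T. (\<integral>\<^sup>+\<theta>\<in>T. init_density E k \<theta> x \<partial>prior E k) /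
             (\<integral>\<^sup>+\<theta>. init_density E k \<theta> x \<partial>prior E k)))"

definition cond_marginal :: "('w, 'x, 't) bayes_setup \<Rightarrow> nat \<Rightarrow> (nat \<Rightarrow> 'x) \<Rightarrow> 'w measure" where
  "cond_marginal E k x = mixture (Omega E) (posterior E k x) (\<lambda>\<theta>. cond_prob E k \<theta> x)"

text \<open>
  \<open>RN_deriv Q P\<close> is \<open>dP/dQ\<close>, and the zero function where no such derivative exists.
\<close>

definition cond_bayes_factor ::
  "('w, 'x, 't) bayes_setup \<Rightarrow> nat \<Rightarrow> (nat \<Rightarrow> 'x) \<Rightarrow> 'w \<Rightarrow> ennreal" where
  "cond_bayes_factor E n x \<omega> =
     RN_deriv (sample_distr E n (cond_marginal E 0 x)) (sample_distr E n (cond_marginal E 1 x))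
       (sample E n \<omega>)"

text \<open>
  The library's \<open>stopping_time\<close> has its values in the index type of the filtration, which leaves
  no room for the value \<open>\<infinity>\<close>.
\<close>

definition bayes_stopping_time :: "('w, 'x, 't) bayes_setup \<Rightarrow> ('w \<Rightarrow> enat) \<Rightarrow> bool" where
  "bayes_stopping_time E \<tau> \<longleftrightarrow>
     (\<forall>\<omega>\<in>space (Omega E). enat (init_len E) < \<tau> \<omega>) \<and>
     (\<forall>n>init_len E. {\<omega> \<in> space (Omega E). \<tau> \<omega> = enat n} \<in> sets (sample_algebra E n))"

definition stopped_bayes_factor ::
  "('w, 'x, 't) bayes_setup \<Rightarrow> ('w \<Rightarrow> enat) \<Rightarrow> (nat \<Rightarrow> 'x) \<Rightarrow> 'w \<Rightarrow> ennreal" where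
  "stopped_bayes_factor E \<tau> x \<omega> =
     (\<Sum>i. let j = Suc (init_len E + i)
          in indicator {\<omega>. \<tau> \<omega> = enat j} \<omega> * cond_bayes_factor E j x \<omega>)"

definition mutually_ac :: "'a measure \<Rightarrow> 'a measure \<Rightarrow> bool" where
  "mutually_ac M N \<longleftrightarrow> absolutely_continuous M N \<and> absolutely_continuous N M"

text \<open>
  Of the suitability of the \<open>\<sigma>\<close>-algebras on the parameter sets, only the measurability in \<open>\<theta>\<close> of
  the integrands in \<open>marginal\<close>, \<open>posterior\<close> and \<open>cond_marginal\<close> is required.
  A function \<open>measure_of\<close> that is not \<open>\<sigma>\<close>-additive yields the zero measure, so the two
  \<open>prob_space\<close> assumptions also say that the formulas do define measures.  The one on
  \<open>cond_marginal\<close> is up to a null set because \<open>cond_prob\<close> is determined only up to one.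
\<close>

locale bayes_setting =
  fixes E :: "('w, 'x, 't) bayes_setup"
  assumes init_space: "space (init_space E) \<subseteq> {1..init_len E} \<rightarrow>\<^sub>E space (obs_space E)"
    and init_sample: "init_sample E \<in> Omega E \<rightarrow>\<^sub>M init_space E"
    and obs: "\<And>i. i > init_len E \<Longrightarrow> obs E i \<in> Omega E \<rightarrow>\<^sub>M obs_space E"
    and model: "\<And>k. k \<in> {0, 1} \<Longrightarrow> model E k \<in> prior E k \<rightarrow>\<^sub>M prob_algebra (Omega E)"
    and sets_ref_measure: "sets (ref_measure E) = sets (Omega E)"
    and ac_model_marginal:
      "\<And>n k \<theta> l. n \<ge> max (init_len E) 1 \<Longrightarrow> k \<in> {0, 1} \<Longrightarrow> \<theta> \<in> space (prior E k) \<Longrightarrow> l \<in> {0, 1} \<Longrightarrow>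
         mutually_ac (sample_distr E n (model E k \<theta>)) (sample_distr E n (marginal E l))"
    and ac_marginals:
      "\<And>n. n \<ge> max (init_len E) 1 \<Longrightarrow>
         mutually_ac (sample_distr E n (marginal E 0)) (sample_distr E n (marginal E 1))"
    and ac_ref_model:
      "\<And>n k \<theta>. n \<ge> max (init_len E) 1 \<Longrightarrow> k \<in> {0, 1} \<Longrightarrow> \<theta> \<in> space (prior E k) \<Longrightarrow>
         mutually_ac (sample_distr E n (ref_measure E)) (sample_distr E n (model E k \<theta>))"
    and ac_ref_marginal:
      "\<And>n k. n \<ge> max (init_len E) 1 \<Longrightarrow> k \<in> {0, 1} \<Longrightarrow>
         mutually_ac (sample_distr E n (ref_measure E)) (sample_distr E n (marginal E k))"
    and sigma_finite_marginal:
      "\<And>n k. n \<ge> max (init_len E) 1 \<Longrightarrow> k \<in> {0, 1} \<Longrightarrow>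
         sigma_finite_measure (sample_distr E n (marginal E k))"
    and init_density_measurable:
      "\<And>k \<theta>. init_len E > 0 \<Longrightarrow> k \<in> {0, 1} \<Longrightarrow> \<theta> \<in> space (prior E k) \<Longrightarrow>
         init_density E k \<theta> \<in> borel_measurable (sample_space E (init_len E))"
    and init_density_version:
      "\<And>k \<theta>. init_len E > 0 \<Longrightarrow> k \<in> {0, 1} \<Longrightarrow> \<theta> \<in> space (prior E k) \<Longrightarrow>
         density (sample_distr E (init_len E) (ref_measure E)) (init_density E k \<theta>) =
         sample_distr E (init_len E) (model E k \<theta>)"
    and init_density_param:
      "\<And>k x. init_len E > 0 \<Longrightarrow> k \<in> {0, 1} \<Longrightarrow> x \<in> space (init_space E) \<Longrightarrow>
         (\<lambda>\<theta>. init_density E k \<theta> x) \<in> borel_measurable (prior E k)"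
    and prob_space_posterior:
      "\<And>k x. k \<in> {0, 1} \<Longrightarrow> x \<in> space (init_space E) \<Longrightarrow> prob_space (posterior E k x)"
    and cond_prob_measurable:
      "\<And>k \<theta> A. k \<in> {0, 1} \<Longrightarrow> \<theta> \<in> space (prior E k) \<Longrightarrow> A \<in> sets (Omega E) \<Longrightarrow>
         (\<lambda>x. cond_prob E k \<theta> x A) \<in> borel_measurable (sample_space E (init_len E))"
    and cond_prob_version:
      "\<And>k \<theta> A. k \<in> {0, 1} \<Longrightarrow> \<theta> \<in> space (prior E k) \<Longrightarrow> A \<in> sets (Omega E) \<Longrightarrow>
         AE \<omega> in model E k \<theta>.
           nn_cond_exp (model E k \<theta>) (sample_algebra E (init_len E)) (indicator A) \<omega> =
           cond_prob E k \<theta> (sample E (init_len E) \<omega>) A"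
    and cond_prob_param:
      "\<And>k x A. k \<in> {0, 1} \<Longrightarrow> x \<in> space (init_space E) \<Longrightarrow> A \<in> sets (Omega E) \<Longrightarrow>
         (\<lambda>\<theta>. cond_prob E k \<theta> x A) \<in> borel_measurable (prior E k)"
    and prob_space_cond_marginal:
      "\<And>k. k \<in> {0, 1} \<Longrightarrow>
         AE x in sample_distr E (init_len E) (ref_measure E). prob_space (cond_marginal E k x)"

end

theory Submission
  imports Defs
begin

text \<open>
  Fix \<open>x\<close> and write \<open>P\<^sub>k\<close> for the conditional marginals given \<open>x\<close>.  By definition of a stopping
  time, the event \<open>\<tau> = j\<close> is decided by the sample of length \<open>j\<close>.  If the Bayes factor \<open>\<beta>\<^sub>j\<close> is
  the density of the \<open>P\<^sub>1\<close>-distribution of that sample with respect to its \<open>P\<^sub>0\<close>-distribution, the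
  \<open>P\<^sub>0\<close>-expectation of \<open>\<beta>\<^sub>j\<close> on \<open>\<tau> = j\<close> is therefore \<open>P\<^sub>1(\<tau> = j)\<close>; if there is no such density,
  \<open>\<beta>\<^sub>j\<close> is zero.  So this expectation is at most \<open>P\<^sub>1(\<tau> = j)\<close> in any case
  (\<open>nn_integral_cond_bayes_factor_le\<close>), and as the events \<open>\<tau> = j\<close> are disjoint, summation over \<open>j\<close>
  bounds the expectation of the stopped Bayes factor by the total mass of \<open>P\<^sub>1\<close>
  (\<open>nn_integral_stopped_bayes_factor_le\<close>).  The bound on the probability of a small inverse Bayes
  factor is then Markov's inequality (\<open>emeasure_inverse_le\<close>).

  The exceptional points \<open>x\<close> are those at which \<open>P\<^sub>1\<close> fails to be a probability measure, so that its
  total mass may differ from \<open>1\<close>.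
\<close>

text \<open>
  If \<open>N\<close> has a density with respect to \<open>M\<close>, equality holds.  Otherwise \<open>RN_deriv M N\<close> is the zero
  function, and the inequality remains.
\<close>

lemma nn_integral_RN_deriv_le:
  assumes "A \<in> sets M"
  shows "(\<integral>\<^sup>+y. indicator A y * RN_deriv M N y \<partial>M) \<le> emeasure N A"
proof (cases "\<exists>f. f \<in> borel_measurable M \<and> density M f = N")
  case True
  then have "density M (RN_deriv M N) = N"
    by (auto simp: RN_derivI)
  then have "emeasure N A = emeasure (density M (RN_deriv M N)) A"
    by simp
  also have "\<dots> = (\<integral>\<^sup>+y. indicator A y * RN_deriv M N y \<partial>M)"
    using assms by (simp add: emeasure_density mult.commute)
  finally show ?thesis by simp
next
  case False
  then have "RN_deriv M N = (\<lambda>_. 0)"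
    by (auto simp: RN_deriv_def)
  then show ?thesis by simp
qed

text \<open>
  For \<open>\<alpha> > 0\<close> the event says \<open>1 \<le> \<alpha> * f \<omega>\<close>, to which Markov's inequality applies.  For \<open>\<alpha> = 0\<close> it
  says \<open>f \<omega> = \<infinity>\<close>, and a function with finite integral is infinite only on a null set.
\<close>

lemma emeasure_inverse_le:
  fixes f :: "'a \<Rightarrow> ennreal" and \<alpha> :: real
  assumes f [measurable]: "f \<in> borel_measurable M"
    and le_1: "(\<integral>\<^sup>+\<omega>. f \<omega> \<partial>M) \<le> 1"
    and "0 \<le> \<alpha>"
  shows "emeasure M {\<omega> \<in> space M. 1 / f \<omega> \<le> ennreal \<alpha>} \<le> ennreal \<alpha>"
proof (cases "\<alpha> = 0")
  case True
  have "emeasure M {\<omega> \<in> space M. 1 / f \<omega> \<le> ennreal \<alpha>} = emeasure M (f -` {\<infinity>} \<inter> space M)"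
    using True by (intro arg_cong[where f = "emeasure M"]) auto
  also have "\<dots> = 0"
    using le_1 by (intro nn_integral_PInf f) (auto simp: top_unique)
  finally show ?thesis by simp
next
  case False
  with \<open>0 \<le> \<alpha>\<close> have "\<alpha> > 0" by simp
  have "1 \<le> ennreal \<alpha> * f \<omega>" if le: "1 / f \<omega> \<le> ennreal \<alpha>" for \<omega>
  proof (cases "f \<omega>")
    case (real r)
    \<comment> \<open>As \<open>1 / 0 = \<infinity>\<close>, a zero of \<open>f\<close> does not belong to the event.\<close>
    have "r > 0"
    proof (rule ccontr)
      assume "\<not> r > 0"
      then have "f \<omega> = 0" using real by simp
      then show False using le by (simp add: top_unique)
    qed
    then have "ennreal (1 / r) \<le> ennreal \<alpha>"
      using le real divide_ennreal[of 1 r] by simp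
    then have "1 / r \<le> \<alpha>" using \<open>\<alpha> > 0\<close> by (simp add: ennreal_le_iff)
    then have "1 \<le> \<alpha> * r" using \<open>r > 0\<close> by (simp add: field_simps)
    then show ?thesis using real \<open>\<alpha> > 0\<close> by (simp flip: ennreal_mult)
  next
    case top
    then show ?thesis using \<open>\<alpha> > 0\<close> by (simp add: ennreal_mult_top)
  qed
  then have "emeasure M {\<omega> \<in> space M. 1 / f \<omega> \<le> ennreal \<alpha>}
      \<le> emeasure M {\<omega> \<in> space M. 1 \<le> ennreal \<alpha> * f \<omega>}"
    by (intro emeasure_mono) auto
  also have "\<dots> \<le> ennreal \<alpha> * (\<integral>\<^sup>+\<omega>. f \<omega> * indicator (space M) \<omega> \<partial>M)"
    by (intro nn_integral_Markov_inequality) auto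
  also have "(\<integral>\<^sup>+\<omega>. f \<omega> * indicator (space M) \<omega> \<partial>M) = (\<integral>\<^sup>+\<omega>. f \<omega> \<partial>M)"
    by (intro nn_integral_cong) simp
  also have "ennreal \<alpha> * \<dots> \<le> ennreal \<alpha>"
    using mult_left_mono[OF le_1, of "ennreal \<alpha>"] by simp
  finally show ?thesis .
qed

text \<open>
  The \<open>\<sigma>\<close>-algebra on samples is a pullback along the splitting into initial segment and later
  observations, so it is enough that these two parts are measurable.
\<close>

lemma sample_measurable:
  assumes "bayes_setting E" and "init_len E \<le> n"
  shows "sample E n \<in> Omega E \<rightarrow>\<^sub>M sample_space E n"
proof -
  interpret bayes_setting E by fact
  let ?m = "init_len E"
  have init: "init_sample E \<omega> \<in> space (init_space E)" if "\<omega> \<in> space (Omega E)" for \<omega>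
    using measurable_space[OF init_sample that] .
  have init_ext: "init_sample E \<omega> \<in> {1..?m} \<rightarrow>\<^sub>E space (obs_space E)"
    if "\<omega> \<in> space (Omega E)" for \<omega>
    by (rule subsetD[OF init_space init[OF that]])
  have initial_segment: "restrict (sample E n \<omega>) {1..?m} = init_sample E \<omega>"
    if "\<omega> \<in> space (Omega E)" for \<omega>
  proof (rule ext)
    fix i
    show "restrict (sample E n \<omega>) {1..?m} i = init_sample E \<omega> i"
      using assms(2) PiE_arb[OF init_ext[OF that], of i]
      by (cases "i \<in> {1..?m}") (auto simp: sample_def)
  qed
  have later_segment: "restrict (sample E n \<omega>) {?m<..n} = (\<lambda>i\<in>{?m<..n}. obs E i \<omega>)" for \<omega>
    by (rule ext) (simp add: sample_def restrict_def)
  have "sample E n \<omega> \<in> {1..n} \<rightarrow>\<^sub>E space (obs_space E)" if "\<omega> \<in> space (Omega E)" for \<omega>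
  proof (rule PiE_I)
    fix i assume "i \<in> {1..n}"
    then show "sample E n \<omega> i \<in> space (obs_space E)"
      using PiE_mem[OF init_ext[OF that], of i] measurable_space[OF obs that, of i]
      by (cases "i \<le> ?m") (auto simp: sample_def)
  next
    fix i assume "i \<notin> {1..n}"
    then show "sample E n \<omega> i = undefined"
      unfolding sample_def by (metis restrict_apply)
  qed
  moreover have "(\<lambda>\<omega>. (init_sample E \<omega>, \<lambda>i\<in>{?m<..n}. obs E i \<omega>)) \<in>
      Omega E \<rightarrow>\<^sub>M init_space E \<Otimes>\<^sub>M (\<Pi>\<^sub>M i\<in>{?m<..n}. obs_space E)"
    by (intro measurable_Pair init_sample measurable_restrict obs) auto
  then have "(\<lambda>\<omega>. (restrict (sample E n \<omega>) {1..?m}, restrict (sample E n \<omega>) {?m<..n})) \<in>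
      Omega E \<rightarrow>\<^sub>M init_space E \<Otimes>\<^sub>M (\<Pi>\<^sub>M i\<in>{?m<..n}. obs_space E)"
    by (subst measurable_cong[where g = "\<lambda>\<omega>. (init_sample E \<omega>, \<lambda>i\<in>{?m<..n}. obs E i \<omega>)"])
       (simp_all add: initial_segment later_segment del: One_nat_def)
  ultimately show ?thesis
    unfolding sample_space_def
    by (intro measurable_vimage_algebra2) (auto simp: initial_segment init simp del: One_nat_def)
qed

lemma stopping_event_preimage:
  assumes "bayes_setting E" and "bayes_stopping_time E \<tau>" and "init_len E < n"
  obtains A where "A \<in> sets (sample_space E n)"
    and "{\<omega> \<in> space (Omega E). \<tau> \<omega> = enat n} = sample E n -` A \<inter> space (Omega E)"
proof -
  have "{\<omega> \<in> space (Omega E). \<tau> \<omega> = enat n} \<in> sets (sample_algebra E n)"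
    using assms by (simp add: bayes_stopping_time_def)
  moreover have "sample E n \<in> space (Omega E) \<rightarrow> space (sample_space E n)"
    using sample_measurable[OF assms(1), of n] assms(3) by (auto simp: measurable_def)
  ultimately show ?thesis
    using that by (auto simp: sample_algebra_def sets_vimage_algebra2)
qed

lemma sets_cond_marginal [simp]: "sets (cond_marginal E k x) = sets (Omega E)"
  unfolding cond_marginal_def mixture_def by (rule sets.sets_measure_of_eq)

lemma space_cond_marginal [simp]: "space (cond_marginal E k x) = space (Omega E)"
  by (rule sets_eq_imp_space_eq) simp

lemma cond_bayes_factor_measurable:
  assumes "bayes_setting E" and "init_len E \<le> n"
  shows "cond_bayes_factor E n x \<in> borel_measurable (Omega E)"
proof -
  have "RN_deriv (sample_distr E n (cond_marginal E 0 x)) (sample_distr E n (cond_marginal E 1 x))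
      \<in> borel_measurable (sample_space E n)"
    by (metis borel_measurable_RN_deriv measurable_cong_sets sample_distr_def sets_distr)
  from measurable_compose[OF sample_measurable[OF assms] this] show ?thesis
    by (simp add: cond_bayes_factor_def[abs_def])
qed

text \<open>
  The event \<open>\<tau> = n\<close> is the preimage of a set \<open>A\<close> of samples of length \<open>n\<close>, so both sides can be
  transported to the distributions of such samples, where \<open>nn_integral_RN_deriv_le\<close> compares them.
\<close>

lemma nn_integral_cond_bayes_factor_le:
  assumes E: "bayes_setting E" and \<tau>: "bayes_stopping_time E \<tau>" and n: "init_len E < n"
  shows "(\<integral>\<^sup>+\<omega>. indicator {\<omega>. \<tau> \<omega> = enat n} \<omega> * cond_bayes_factor E n x \<omega> \<partial>cond_marginal E 0 x)
           \<le> emeasure (cond_marginal E 1 x) {\<omega> \<in> space (Omega E). \<tau> \<omega> = enat n}"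
proof -
  obtain A where A: "A \<in> sets (sample_space E n)"
    and event: "{\<omega> \<in> space (Omega E). \<tau> \<omega> = enat n} = sample E n -` A \<inter> space (Omega E)"
    using stopping_event_preimage[OF E \<tau> n] .
  let ?Q = "\<lambda>k. sample_distr E n (cond_marginal E k x)"
  let ?r = "RN_deriv (?Q 0) (?Q 1)"
  have sample: "sample E n \<in> cond_marginal E k x \<rightarrow>\<^sub>M sample_space E n" for k
    using sample_measurable[OF E, of n] n
    by (simp add: measurable_cong_sets[OF sets_cond_marginal refl])
  have sets_Q: "sets (?Q k) = sets (sample_space E n)" for k
    by (simp add: sample_distr_def)
  have r: "(\<lambda>y. indicator A y * ?r y)
      \<in> borel_measurable (distr (cond_marginal E 0 x) (sample_space E n) (sample E n))"
    using A borel_measurable_RN_deriv[of "?Q 0" "?Q 1"] by (simp add: sample_distr_def)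
  have "(\<integral>\<^sup>+\<omega>. indicator {\<omega>. \<tau> \<omega> = enat n} \<omega> * cond_bayes_factor E n x \<omega> \<partial>cond_marginal E 0 x)
      = (\<integral>\<^sup>+\<omega>. indicator A (sample E n \<omega>) * ?r (sample E n \<omega>) \<partial>cond_marginal E 0 x)"
    using event by (intro nn_integral_cong) (auto simp: cond_bayes_factor_def indicator_def)
  also have "\<dots> = (\<integral>\<^sup>+y. indicator A y * ?r y \<partial>?Q 0)"
    using r unfolding sample_distr_def by (subst nn_integral_distr[OF sample]) auto
  also have "\<dots> \<le> emeasure (?Q 1) A"
    using A by (intro nn_integral_RN_deriv_le) (simp add: sets_Q)
  also have "\<dots> = emeasure (cond_marginal E 1 x) {\<omega> \<in> space (Omega E). \<tau> \<omega> = enat n}"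
    using A event by (simp add: sample_distr_def emeasure_distr[OF sample])
  finally show ?thesis .
qed

lemma stopping_event_measurable:
  assumes "bayes_setting E" and "bayes_stopping_time E \<tau>" and "init_len E < n"
  shows "{\<omega> \<in> space (Omega E). \<tau> \<omega> = enat n} \<in> sets (Omega E)"
proof (rule stopping_event_preimage[OF assms])
  fix A
  assume A: "A \<in> sets (sample_space E n)"
    and "{\<omega> \<in> space (Omega E). \<tau> \<omega> = enat n} = sample E n -` A \<inter> space (Omega E)"
  then show ?thesis
    using measurable_sets[OF sample_measurable[OF assms(1)] A] assms(3) by simp
qed

lemma stopped_term_measurable:
  assumes "bayes_setting E" and "bayes_stopping_time E \<tau>" and "init_len E < n"
  shows "(\<lambda>\<omega>. indicator {\<omega>. \<tau> \<omega> = enat n} \<omega> * cond_bayes_factor E n x \<omega>)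
           \<in> borel_measurable (Omega E)"
proof -
  have [measurable]: "cond_bayes_factor E n x \<in> borel_measurable (Omega E)"
    using cond_bayes_factor_measurable[OF assms(1)] assms(3) by simp
  have [measurable]: "Measurable.pred (Omega E) (\<lambda>\<omega>. \<tau> \<omega> = enat n)"
    using stopping_event_measurable[OF assms] by (simp add: pred_def)
  show ?thesis by measurable
qed

lemma stopped_bayes_factor_measurable:
  assumes "bayes_setting E" and "bayes_stopping_time E \<tau>"
  shows "stopped_bayes_factor E \<tau> x \<in> borel_measurable (Omega E)"
  unfolding stopped_bayes_factor_def[abs_def] Let_def
  by (intro borel_measurable_suminf_order stopped_term_measurable[OF assms]) simp

lemma nn_integral_stopped_bayes_factor_le:
  assumes E: "bayes_setting E" and \<tau>: "bayes_stopping_time E \<tau>"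
  shows "(\<integral>\<^sup>+\<omega>. stopped_bayes_factor E \<tau> x \<omega> \<partial>cond_marginal E 0 x)
           \<le> emeasure (cond_marginal E 1 x) (space (Omega E))"
proof -
  let ?j = "\<lambda>i. Suc (init_len E + i)"
  let ?A = "\<lambda>i. {\<omega> \<in> space (Omega E). \<tau> \<omega> = enat (?j i)}"
  have "(\<integral>\<^sup>+\<omega>. stopped_bayes_factor E \<tau> x \<omega> \<partial>cond_marginal E 0 x) =
      (\<Sum>i. \<integral>\<^sup>+\<omega>. indicator {\<omega>. \<tau> \<omega> = enat (?j i)} \<omega> * cond_bayes_factor E (?j i) x \<omega>
        \<partial>cond_marginal E 0 x)"
    unfolding stopped_bayes_factor_def Let_def
    using stopped_term_measurable[OF E \<tau>]
    by (intro nn_integral_suminf) (simp add: measurable_cong_sets[OF sets_cond_marginal refl])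
  also have "\<dots> \<le> (\<Sum>i. emeasure (cond_marginal E 1 x) (?A i))"
    by (intro suminf_le nn_integral_cond_bayes_factor_le[OF E \<tau>]) auto
  also have "\<dots> = emeasure (cond_marginal E 1 x) (\<Union>i. ?A i)"
    using stopping_event_measurable[OF E \<tau>]
    by (intro suminf_emeasure) (auto simp: disjoint_family_on_def)
  also have "\<dots> \<le> emeasure (cond_marginal E 1 x) (space (Omega E))"
    by (intro emeasure_mono) auto
  finally show ?thesis .
qed

theorem proposition4:
  fixes E :: "('w, 'x, 't) bayes_setup" and \<tau> :: "'w \<Rightarrow> enat"
  assumes "bayes_setting E"
    and "bayes_stopping_time E \<tau>"
    and "\<And>k x. k \<in> {0, 1} \<Longrightarrow> x \<in> space (init_space E) \<Longrightarrow>
           emeasure (cond_marginal E k x) {\<omega> \<in> space (Omega E). \<tau> \<omega> = \<infinity>} = 0"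
  shows "AE x in sample_distr E (init_len E) (ref_measure E).
           (\<integral>\<^sup>+\<omega>. stopped_bayes_factor E \<tau> x \<omega> \<partial>cond_marginal E 0 x) \<le> 1 \<and>
           (\<forall>\<alpha>::real. 0 \<le> \<alpha> \<and> \<alpha> \<le> 1 \<longrightarrow>
              emeasure (cond_marginal E 0 x)
                {\<omega> \<in> space (Omega E). 1 / stopped_bayes_factor E \<tau> x \<omega> \<le> ennreal \<alpha>}
              \<le> ennreal \<alpha>)"
proof -
  interpret bayes_setting E by fact
  have "AE x in sample_distr E (init_len E) (ref_measure E). prob_space (cond_marginal E 1 x)"
    by (simp add: prob_space_cond_marginal)
  then show ?thesis
  proof (rule eventually_mono)
    fix x assume "prob_space (cond_marginal E 1 x)"
    then have "emeasure (cond_marginal E 1 x) (space (Omega E)) = 1"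
      by (metis prob_space.emeasure_space_1 space_cond_marginal)
    with nn_integral_stopped_bayes_factor_le[OF assms(1,2), of x]
    have expectation: "(\<integral>\<^sup>+\<omega>. stopped_bayes_factor E \<tau> x \<omega> \<partial>cond_marginal E 0 x) \<le> 1"
      by simp
    have "stopped_bayes_factor E \<tau> x \<in> borel_measurable (cond_marginal E 0 x)"
      using stopped_bayes_factor_measurable[OF assms(1,2)]
      by (simp add: measurable_cong_sets[OF sets_cond_marginal refl])
    from expectation emeasure_inverse_le[OF this expectation]
    show "(\<integral>\<^sup>+\<omega>. stopped_bayes_factor E \<tau> x \<omega> \<partial>cond_marginal E 0 x) \<le> 1 \<and>
        (\<forall>\<alpha>::real. 0 \<le> \<alpha> \<and> \<alpha> \<le> 1 \<longrightarrow>
           emeasure (cond_marginal E 0 x)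
             {\<omega> \<in> space (Omega E). 1 / stopped_bayes_factor E \<tau> x \<omega> \<le> ennreal \<alpha>}
           \<le> ennreal \<alpha>)"
      by simp
  qed
qed

end
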